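(* Let $n\in\mathbb{N}$, $n\ge1$, and let $G \in \mathcal{S}_{od}(\mathbb{R}^{2n})$. Then $$\operatorname{div}_{1/2} G \in \mathcal{S}(\mathbb{R}^n),$$ where the $1/2$-divergence is defined, for all $x \in \mathbb{R}^n$, by $$\operatorname{div}_{1/2} G(x) := \int_{\mathbb{R}^n} \frac{2G(x,y)}{|x-y|^{1/2}} \frac{dy}{| x-y |^n} = \int_{\mathbb{R}^n} \frac{G(x,y) - G(y,x)}{|x-y|^{1/2}} \frac{dy}{| x-y |^n}.$$ In addition, the map $G \mapsto \operatorname{div}_{1/2} G$ from $\mathcal{S}_{od}(\mathbb{R}^{2n})$ to $\mathcal{S}(\mathbb{R}^n)$ is continuous with respect to the Schwartz topologies.
   Context: $\mathcal{S}(\mathbb{R}^m)$ is the space of complex-valued Schwartz functions on $\mathbb{R}^m$ with its usual Fréchet topology given by the Schwartz seminorms. $\mathcal{S}_{od}(\mathbb{R}^{2n})$ (off-diagonal Schwartz functions) is the set of $G \in \mathcal{S}(\mathbb{R}^{2n})$, $G = G(x,y)$ with $x,y\in\mathbb{R}^n$, such that $G(x,y) = -G(y,x)$ for all $x,y$ and $\partial_x^{\alpha}\partial_y^{\beta} G(z,z) = 0$ for all $z \in \mathbb{R}^n$ and all multi-indices $\alpha,\beta \in \mathbb{N}_0^n$; it carries the subspace topology of $\mathcal{S}(\mathbb{R}^{2n})$. *)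

theory Defs
  imports "HOL-Analysis.Analysis"
begin

section \<open>Partial derivatives and smooth functions on Euclidean spaces\<close>

definition partial :: "'a::euclidean_space \<Rightarrow> ('a \<Rightarrow> complex) \<Rightarrow> 'a \<Rightarrow> complex" where
  "partial b f x = vector_derivative (\<lambda>t. f (x + t *\<^sub>R b)) (at 0)"

text \<open>\<open>f\<close> is of class $C^\infty$: all iterated coordinate partial derivatives of \<open>f\<close>, of every
  order and taken in any order of the coordinates, exist. Each of them is required to be Frechet
  differentiable, which yields both the existence of the next partial derivatives and continuity.\<close>

definition smooth :: "('a::euclidean_space \<Rightarrow> complex) \<Rightarrow> bool" where
  "smooth f \<longleftrightarrow> (\<forall>bs \<in> lists Basis. foldr partial bs f differentiable_on UNIV)"

text \<open>A multi-index on \<open>'a\<close> is a function \<open>\<alpha> :: 'a \<Rightarrow> nat\<close> of which only the values on \<open>Basis\<close>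
  are used. An abstract Euclidean space has no canonical ordering of its standard basis, so one is
  fixed here; it only determines the order in which partial derivatives are taken in
  \<open>mderiv\<close>, which is immaterial for smooth functions.\<close>

definition basis_list :: "'a::euclidean_space list" where
  "basis_list = (SOME bs. distinct bs \<and> set bs = Basis)"

definition mderiv :: "('a::euclidean_space \<Rightarrow> nat) \<Rightarrow> ('a \<Rightarrow> complex) \<Rightarrow> 'a \<Rightarrow> complex" where
  "mderiv \<alpha> f = foldr (\<lambda>b. partial b ^^ \<alpha> b) basis_list f"

definition monomial :: "('a::euclidean_space \<Rightarrow> nat) \<Rightarrow> 'a \<Rightarrow> real" where
  "monomial \<alpha> x = (\<Prod>b\<in>Basis. (x \<bullet> b) ^ \<alpha> b)"

section \<open>The Schwartz space\<close>

definition schwartz :: "('a::euclidean_space \<Rightarrow> complex) set" where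
  "schwartz = {f. smooth f \<and>
     (\<forall>\<alpha> \<beta>. bounded (range (\<lambda>x. monomial \<alpha> x *\<^sub>R mderiv \<beta> f x)))}"

definition schwartz_seminorm ::
    "('a::euclidean_space \<Rightarrow> nat) \<Rightarrow> ('a \<Rightarrow> nat) \<Rightarrow> ('a \<Rightarrow> complex) \<Rightarrow> real" where
  "schwartz_seminorm \<alpha> \<beta> f = (SUP x. norm (monomial \<alpha> x *\<^sub>R mderiv \<beta> f x))"

text \<open>The locally convex topology of the family of seminorms: the open seminorm balls around
  all points form a subbase.\<close>

definition schwartz_topology :: "('a::euclidean_space \<Rightarrow> complex) topology" where
  "schwartz_topology = topology_generated_by
     {{g \<in> schwartz. schwartz_seminorm \<alpha> \<beta> (\<lambda>x. g x - f x) < \<epsilon>} | f \<alpha> \<beta> \<epsilon>.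
        f \<in> schwartz \<and> \<epsilon> > 0}"

lemma topspace_schwartz_topology: "topspace schwartz_topology = schwartz"
proof -
  have zero: "partial b (\<lambda>x. 0) = (\<lambda>x. 0)" for b :: 'a
    by (simp add: partial_def fun_eq_iff)
  have "(partial b ^^ k) (\<lambda>x. 0) = (\<lambda>x. 0)" for b :: 'a and k
    by (induction k) (simp_all add: zero)
  then have "foldr (\<lambda>b. partial b ^^ \<beta> b) bs (\<lambda>x. 0) = (\<lambda>x. 0)" for \<beta> :: "'a \<Rightarrow> nat" and bs
    by (induction bs) simp_all
  then have "schwartz_seminorm \<alpha> \<beta> (\<lambda>x::'a. 0) = 0" for \<alpha> \<beta>
    by (simp add: schwartz_seminorm_def mderiv_def)
  then have ball: "f \<in> {g \<in> schwartz. schwartz_seminorm (\<lambda>_. 0) (\<lambda>_. 0) (\<lambda>x. g x - f x) < 1}"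
    if "f \<in> schwartz" for f :: "'a \<Rightarrow> complex"
    using that by simp
  show ?thesis
    unfolding schwartz_topology_def topology_generated_by_topspace
  proof (intro subset_antisym subsetI)
    fix f :: "'a \<Rightarrow> complex" assume f: "f \<in> schwartz"
    show "f \<in> \<Union> {{g \<in> schwartz. schwartz_seminorm \<alpha> \<beta> (\<lambda>x. g x - f x) < \<epsilon>} | f \<alpha> \<beta> \<epsilon>.
        f \<in> schwartz \<and> \<epsilon> > 0}"
    proof (rule UnionI[OF _ ball[OF f]], unfold mem_Collect_eq, intro exI conjI)
      show "f \<in> schwartz" by (fact f)
      show "(0::real) < 1" by simp
    qed (rule refl)
  qed auto
qed

section \<open>Off-diagonal Schwartz functions and the half-divergence\<close>

text \<open>$\mathbb{R}^{2n}$ is rendered as $\mathbb{R}^n \times \mathbb{R}^n$. The derivative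
  $\partial_x^\alpha \partial_y^\beta G(z,z)$ is taken in the two blocks of variables separately
  and then evaluated at $x = y = z$.\<close>

definition schwartz_od :: "((real ^ 'n) \<times> (real ^ 'n) \<Rightarrow> complex) set" where
  "schwartz_od = {G \<in> schwartz.
     (\<forall>x y. G (x, y) = - G (y, x)) \<and>
     (\<forall>z \<alpha> \<beta>. mderiv \<alpha> (\<lambda>x. mderiv \<beta> (\<lambda>y. G (x, y)) z) z = 0)}"

text \<open>The value of the integrand on the null set \<open>y = x\<close> is \<open>0\<close>, as division by zero gives zero.\<close>

definition div_half_integrand ::
    "((real ^ 'n) \<times> (real ^ 'n) \<Rightarrow> complex) \<Rightarrow> real ^ 'n \<Rightarrow> real ^ 'n \<Rightarrow> complex" where
  "div_half_integrand G x y =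
     2 * G (x, y) / of_real (norm (x - y) powr (1/2)) / of_real (norm (x - y) ^ CARD('n))"

definition div_half :: "((real ^ 'n) \<times> (real ^ 'n) \<Rightarrow> complex) \<Rightarrow> real ^ 'n \<Rightarrow> complex" where
  "div_half G x = (LINT y|lborel. div_half_integrand G x y)"

end

theory Submission
  imports Defs
begin

text \<open>
  The singularity $|x-y|^{-n-1/2}$ exceeds the critical order $n$ by one half, while the vanishing of
  \<open>G\<close> on the diagonal gains a full order, so the integral converges. Put \<open>y = x + h\<close>, so that
  $$\mathrm{div}_{1/2} G(x) = \int 2\, G(x,x+h)\, |h|^{-n-1/2}\, dh.$$
  Antisymmetry gives $G(x,x)=0$, and the mean value inequality in the second variable, together with
  the boundedness of \<open>G\<close> and its first derivatives against any weight $x^\alpha$, yields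
  $$|x^\alpha G(x,x+h)| \le M_\alpha(G) \min(1,|h|),$$
  where $M_\alpha(G)$ is a finite sum of Schwartz seminorms (\<open>antisym_schwartz_near_diagonal\<close>). The
  function $\min(1,|h|)\,|h|^{-n-1/2}$ is integrable (\<open>integrable_offset_kernel\<close>). Hence the integral
  exists and $|x^\alpha\, \mathrm{div}_{1/2} G(x)|$ is bounded by a multiple of $M_\alpha(G)$
  (\<open>offset_div_bound\<close>).

  Derivatives cost nothing more. In the variables $(x,h)$ a derivative in $x$ acts on \<open>G\<close> as the
  derivative $T_b = \partial_{x_b} + \partial_{y_b}$ along the diagonal, and $T_b G$ is again an
  antisymmetric Schwartz function. Dominated convergence gives
  $\partial_b\, \mathrm{div}_{1/2} G = \mathrm{div}_{1/2} (T_b G)$ (\<open>has_derivative_offset_div\<close>,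
  \<open>partial_offset_div\<close>), and by iteration every derivative of the half-divergence obeys the same
  estimate. Therefore each Schwartz seminorm of $\mathrm{div}_{1/2} G$ is at most a multiple of a finite
  sum of Schwartz seminorms of \<open>G\<close> (\<open>offset_div_seminorm_dominated\<close>); since the map is linear, this is
  continuity (\<open>continuous_map_schwartzI\<close>).

  To express seminorms of $T_b G$ by seminorms of \<open>G\<close>, partial derivatives have to commute
  (\<open>partial_commute\<close>), because \<open>mderiv\<close> takes them in one fixed order.
\<close>

section \<open>Partial derivatives and Young's theorem\<close>

lemma has_derivative_partial_eq:
  assumes D: "(f has_derivative D) (at x)"
  shows "partial b f x = D b"
proof -
  interpret D: bounded_linear D using D by (rule has_derivative_bounded_linear)
  have "((\<lambda>t. f (x + t *\<^sub>R b)) has_vector_derivative D b) (at 0)"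
    unfolding has_vector_derivative_def
    by (rule has_derivative_eq_rhs[OF has_derivative_compose[where f = "\<lambda>t. x + t *\<^sub>R b"]])
      (auto intro!: derivative_eq_intros simp: D.scaleR intro: D)
  then show ?thesis unfolding partial_def by (rule vector_derivative_at)
qed

lemma has_vector_derivative_partial:
  assumes "f differentiable (at (x + s *\<^sub>R b))"
  shows "((\<lambda>t. f (x + t *\<^sub>R b)) has_vector_derivative partial b f (x + s *\<^sub>R b)) (at s)"
proof -
  obtain D where D: "(f has_derivative D) (at (x + s *\<^sub>R b))"
    using assms by (auto simp: differentiable_def)
  show ?thesis
    unfolding has_vector_derivative_def
    by (rule has_derivative_eq_rhs[OF has_derivative_compose[where f = "\<lambda>t. x + t *\<^sub>R b"]])
      (auto intro!: derivative_eq_intros intro: D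
        simp: linear_cmul[OF has_derivative_linear[OF D]] has_derivative_partial_eq[OF D])
qed

text \<open>The second difference is the increment of \<open>f (x + s b + t c) - f (x + s b)\<close> as \<open>s\<close> runs from \<open>0\<close> to \<open>t\<close>.
The derivative in \<open>s\<close> is a first difference of \<open>partial b f\<close>, which equals \<open>t\<close> times the mixed
derivative up to \<open>o(t)\<close>, uniformly for \<open>s\<close> between \<open>0\<close> and \<open>t\<close>, because \<open>partial b f\<close> is Frechet
differentiable at \<open>x\<close>; the mean value inequality concludes.\<close>

lemma second_difference_tendsto:
  fixes f :: "'a::euclidean_space \<Rightarrow> complex"
  assumes f: "\<And>y. f differentiable (at y)" and pf: "partial b f differentiable (at x)"
    and b: "norm b = 1" and c: "norm c = 1"
  shows "((\<lambda>t. (f (x + t *\<^sub>R b + t *\<^sub>R c) - f (x + t *\<^sub>R b) - f (x + t *\<^sub>R c) + f x) /\<^sub>R t\<^sup>2)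
    \<longlongrightarrow> partial c (partial b f) x) (at_right 0)"
proof (rule tendstoI)
  fix e :: real assume "e > 0"
  obtain L where L: "(partial b f has_derivative L) (at x)"
    using pf by (auto simp: differentiable_def)
  interpret L: bounded_linear L using L by (rule has_derivative_bounded_linear)
  have Lc: "partial c (partial b f) x = L c" by (rule has_derivative_partial_eq[OF L])
  \<comment> \<open>The estimate below produces the factor \<open>3\<close>: the two points compared are within \<open>2 * t\<close> and \<open>t\<close> of \<open>x\<close>.\<close>
  define e' where "e' = e / 4"
  have "e' > 0" using \<open>e > 0\<close> by (simp add: e'_def)
  then obtain d where d: "d > 0" and dL: "\<And>y. norm (y - x) < d \<Longrightarrow>
      norm (partial b f y - partial b f x - L (y - x)) \<le> e' * norm (y - x)"
    using L unfolding has_derivative_at_alt by blast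
  have "dist ((f (x + t *\<^sub>R b + t *\<^sub>R c) - f (x + t *\<^sub>R b) - f (x + t *\<^sub>R c) + f x) /\<^sub>R t\<^sup>2)
      (L c) < e" if t: "0 < t" "t < d / 2" for t
  proof -
    \<comment> \<open>Subtracting the linear term makes the derivative of \<open>g\<close> small rather than merely convergent.\<close>
    define g where "g s = f (x + t *\<^sub>R c + s *\<^sub>R b) - f (x + s *\<^sub>R b) - s *\<^sub>R t *\<^sub>R L c" for s
    have g': "(g has_vector_derivative partial b f (x + t *\<^sub>R c + s *\<^sub>R b)
        - partial b f (x + s *\<^sub>R b) - t *\<^sub>R L c) (at s)" for s
      unfolding g_def
      by (intro has_vector_derivative_diff has_vector_derivative_partial f)
        (auto intro!: derivative_eq_intros simp: has_vector_derivative_def)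
    have bnd: "norm (partial b f (x + t *\<^sub>R c + s *\<^sub>R b) - partial b f (x + s *\<^sub>R b) - t *\<^sub>R L c)
        \<le> 3 * e' * t" if s: "s \<in> {0..t}" for s
    proof -
      let ?u = "t *\<^sub>R c + s *\<^sub>R b" and ?v = "s *\<^sub>R b"
      have u: "norm ?u \<le> 2 * t"
        using norm_triangle_ineq[of "t *\<^sub>R c" "s *\<^sub>R b"] s t b c by simp
      have v: "norm ?v \<le> t" using s b by simp
      have 1: "norm (partial b f (x + ?u) - partial b f x - L ?u) \<le> e' * norm ?u"
        using dL[of "x + ?u"] u t by simp
      have 2: "norm (partial b f (x + ?v) - partial b f x - L ?v) \<le> e' * norm ?v"
        using dL[of "x + ?v"] v t by simp
      have "partial b f (x + t *\<^sub>R c + s *\<^sub>R b) - partial b f (x + s *\<^sub>R b) - t *\<^sub>R L c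
          = (partial b f (x + ?u) - partial b f x - L ?u)
            - (partial b f (x + ?v) - partial b f x - L ?v)"
        by (simp add: L.add L.scaleR algebra_simps)
      also have "norm \<dots> \<le> e' * norm ?u + e' * norm ?v"
        by (rule order_trans[OF norm_triangle_ineq4 add_mono[OF 1 2]])
      also have "\<dots> \<le> e' * (2 * t) + e' * t"
        using u v \<open>e' > 0\<close> by (intro add_mono mult_left_mono) auto
      finally show ?thesis by (simp add: algebra_simps)
    qed
    have "norm (g t - g 0) \<le> 3 * e' * t * norm (t - 0)"
    proof (rule differentiable_bound[of "{0..t}"])
      fix s assume s: "s \<in> {0..t}"
      let ?D = "partial b f (x + t *\<^sub>R c + s *\<^sub>R b) - partial b f (x + s *\<^sub>R b) - t *\<^sub>R L c"
      show "(g has_derivative (\<lambda>h. h *\<^sub>R ?D)) (at s within {0..t})"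
        using g'[of s] unfolding has_vector_derivative_def by (rule has_derivative_at_withinI)
      show "onorm (\<lambda>h. h *\<^sub>R ?D) \<le> 3 * e' * t"
        using bnd[OF s] by (intro onorm_le) (simp add: mult.commute mult_left_mono)
    qed (use t in auto)
    moreover have "g t - g 0 = t\<^sup>2 *\<^sub>R
        ((f (x + t *\<^sub>R b + t *\<^sub>R c) - f (x + t *\<^sub>R b) - f (x + t *\<^sub>R c) + f x) /\<^sub>R t\<^sup>2 - L c)"
      using t by (simp add: g_def scaleR_diff_right power2_eq_square algebra_simps)
    ultimately have "t\<^sup>2 * norm ((f (x + t *\<^sub>R b + t *\<^sub>R c) - f (x + t *\<^sub>R b) - f (x + t *\<^sub>R c) + f x) /\<^sub>R t\<^sup>2 - L c)
        \<le> t\<^sup>2 * (3 * e')"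
      using t by (simp add: power2_eq_square mult_ac)
    then have "norm ((f (x + t *\<^sub>R b + t *\<^sub>R c) - f (x + t *\<^sub>R b) - f (x + t *\<^sub>R c) + f x) /\<^sub>R t\<^sup>2 - L c)
        \<le> 3 * e'"
      using t by (subst (asm) mult_le_cancel_left_pos) auto
    also have "\<dots> < e" using \<open>e > 0\<close> by (simp add: e'_def)
    finally show ?thesis by (simp add: dist_norm)
  qed
  then show "\<forall>\<^sub>F t in at_right 0. dist ((f (x + t *\<^sub>R b + t *\<^sub>R c) - f (x + t *\<^sub>R b) - f (x + t *\<^sub>R c) + f x) /\<^sub>R t\<^sup>2)
      (partial c (partial b f) x) < e"
    unfolding Lc eventually_at_right_field using d by (intro exI[of _ "d / 2"]) auto
qed

text \<open>The second difference does not change when \<open>b\<close> and \<open>c\<close> are exchanged, so both mixed derivatives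
are limits of the same quotient.\<close>

lemma partial_commute:
  fixes f :: "'a::euclidean_space \<Rightarrow> complex"
  assumes "\<And>y. f differentiable (at y)"
    and "\<And>y. partial b f differentiable (at y)" "\<And>y. partial c f differentiable (at y)"
    and "b \<in> Basis" "c \<in> Basis"
  shows "partial b (partial c f) = partial c (partial b f)"
proof
  fix x
  have "((\<lambda>t. (f (x + t *\<^sub>R b + t *\<^sub>R c) - f (x + t *\<^sub>R b) - f (x + t *\<^sub>R c) + f x) /\<^sub>R t\<^sup>2)
    \<longlongrightarrow> partial c (partial b f) x) (at_right 0)"
    using assms by (intro second_difference_tendsto) auto
  moreover have "((\<lambda>t. (f (x + t *\<^sub>R c + t *\<^sub>R b) - f (x + t *\<^sub>R c) - f (x + t *\<^sub>R b) + f x) /\<^sub>R t\<^sup>2)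
    \<longlongrightarrow> partial b (partial c f) x) (at_right 0)"
    using assms by (intro second_difference_tendsto) auto
  ultimately show "partial b (partial c f) x = partial c (partial b f) x"
    by (intro tendsto_unique[OF trivial_limit_at_right_real])
      (simp_all add: algebra_simps)
qed

section \<open>Smooth functions\<close>

lemma smooth_differentiable: "smooth f \<Longrightarrow> f differentiable (at x)"
  unfolding smooth_def differentiable_on_def by (drule bspec[of _ _ "[]"]) auto

lemma smooth_partial:
  assumes "smooth f" "b \<in> Basis"
  shows "smooth (partial b f)"
  unfolding smooth_def
proof
  fix bs :: "'a list" assume "bs \<in> lists Basis"
  then have "bs @ [b] \<in> lists Basis" using assms(2) by auto
  then have "foldr partial (bs @ [b]) f differentiable_on UNIV"
    using assms(1) unfolding smooth_def by blast
  then show "foldr partial bs (partial b f) differentiable_on UNIV" by simp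
qed

text \<open>Coinduction is the way to show that an explicitly given family of functions is smooth: it suffices
that the family consists of differentiable functions and is stable under partial derivatives.\<close>

lemma smooth_coinduct:
  fixes f :: "'a::euclidean_space \<Rightarrow> complex"
  assumes "P f" and "\<And>f x. P f \<Longrightarrow> f differentiable (at x)"
    and "\<And>f b. P f \<Longrightarrow> b \<in> Basis \<Longrightarrow> P (partial b f)"
  shows "smooth f"
  unfolding smooth_def
proof
  fix bs :: "'a list" assume "bs \<in> lists Basis"
  then have "P (foldr partial bs f)" by (induction bs) (auto intro: assms)
  then show "foldr partial bs f differentiable_on UNIV"
    by (auto simp: differentiable_on_def intro: assms(2))
qed

lemma partial_lincomb:
  assumes "f differentiable (at x)" "g differentiable (at x)"
  shows "partial b (\<lambda>x. c * f x + d * g x) x = c * partial b f x + d * partial b g x"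
proof -
  from assms obtain F G where "(f has_derivative F) (at x)" "(g has_derivative G) (at x)"
    by (auto simp: differentiable_def)
  moreover from this have "((\<lambda>x. c * f x + d * g x) has_derivative (\<lambda>v. c * F v + d * G v)) (at x)"
    by (auto intro!: derivative_eq_intros)
  ultimately show ?thesis by (simp add: has_derivative_partial_eq)
qed

lemma partial_lincomb_smooth:
  assumes "smooth f" "smooth g"
  shows "partial b (\<lambda>x. c * f x + d * g x) = (\<lambda>x. c * partial b f x + d * partial b g x)"
  using assms by (intro ext partial_lincomb smooth_differentiable)

lemma smooth_lincomb:
  fixes f g :: "'a::euclidean_space \<Rightarrow> complex"
  assumes "smooth f" "smooth g"
  shows "smooth (\<lambda>x. c * f x + d * g x)"
proof (rule smooth_coinduct[where P = "\<lambda>h. \<exists>f g. smooth f \<and> smooth g \<and> h = (\<lambda>x. c * f x + d * g x)"])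
  show "\<exists>f' g'. smooth f' \<and> smooth g' \<and> (\<lambda>x. c * f x + d * g x) = (\<lambda>x. c * f' x + d * g' x)"
    using assms by blast
next
  fix h :: "'a \<Rightarrow> complex" and x assume "\<exists>f g. smooth f \<and> smooth g \<and> h = (\<lambda>x. c * f x + d * g x)"
  then show "h differentiable (at x)"
    by (auto intro!: differentiable_add differentiable_mult intro: smooth_differentiable)
next
  fix h :: "'a \<Rightarrow> complex" and b :: 'a assume "\<exists>f g. smooth f \<and> smooth g \<and> h = (\<lambda>x. c * f x + d * g x)" "b \<in> Basis"
  then show "\<exists>f g. smooth f \<and> smooth g \<and> partial b h = (\<lambda>x. c * f x + d * g x)"
    by (metis partial_lincomb_smooth smooth_partial)
qed

lemma partial_commute_smooth:
  assumes "smooth f" "b \<in> Basis" "c \<in> Basis"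
  shows "partial b (partial c f) = partial c (partial b f)"
  using assms by (intro partial_commute) (auto intro: smooth_differentiable smooth_partial)

lemma smooth_partial_pow:
  assumes "smooth f" "b \<in> Basis"
  shows "smooth ((partial b ^^ k) f)"
  using assms by (induction k) (auto intro: smooth_partial)

lemma smooth_foldr_partial_pow:
  assumes "smooth f" "set bs \<subseteq> Basis"
  shows "smooth (foldr (\<lambda>b. partial b ^^ \<alpha> b) bs f)"
  using assms by (induction bs) (auto intro: smooth_partial_pow)

lemma basis_list: "distinct (basis_list :: 'a::euclidean_space list)"
  "set (basis_list :: 'a list) = Basis"
proof -
  have "\<exists>bs :: 'a list. distinct bs \<and> set bs = Basis"
    using finite_distinct_list[OF finite_Basis] by blast
  from someI_ex[OF this] show "distinct (basis_list :: 'a list)" "set (basis_list :: 'a list) = Basis"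
    unfolding basis_list_def by auto
qed

lemma partial_pow_commute:
  assumes "smooth f" "b \<in> Basis" "c \<in> Basis"
  shows "(partial b ^^ k) (partial c f) = partial c ((partial b ^^ k) f)"
proof (induction k)
  case (Suc k)
  then show ?case
    using partial_commute_smooth[OF smooth_partial_pow[OF assms(1,2)] assms(2,3)] by simp
qed simp

lemma foldr_partial_pow_commute:
  assumes "smooth f" "set bs \<subseteq> Basis" "c \<in> Basis"
  shows "foldr (\<lambda>b. partial b ^^ \<alpha> b) bs (partial c f) = partial c (foldr (\<lambda>b. partial b ^^ \<alpha> b) bs f)"
  using assms(2)
  by (induction bs) (use assms in \<open>auto simp: partial_pow_commute smooth_foldr_partial_pow\<close>)

text \<open>Commuting partial derivatives make the fixed order of the basis in \<open>mderiv\<close> irrelevant, so a further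
derivative just raises one exponent. This is what makes the Schwartz space stable under \<open>partial\<close>.\<close>

lemma mderiv_partial:
  fixes f :: "'a::euclidean_space \<Rightarrow> complex"
  assumes f: "smooth f" and b: "b \<in> Basis"
  shows "mderiv \<alpha> (partial b f) = mderiv (\<alpha>(b := Suc (\<alpha> b))) f"
proof -
  let ?\<alpha> = "\<alpha>(b := Suc (\<alpha> b))"
  have "foldr (\<lambda>b. partial b ^^ \<alpha> b) bs (partial b f) = foldr (\<lambda>b. partial b ^^ ?\<alpha> b) bs f"
    if "distinct bs" "set bs \<subseteq> Basis" "b \<in> set bs" for bs :: "'a list"
    using that
  proof (induction bs)
    case (Cons a bs)
    show ?case
    proof (cases "a = b")
      case True
      then have "foldr (\<lambda>b. partial b ^^ ?\<alpha> b) bs f = foldr (\<lambda>b. partial b ^^ \<alpha> b) bs f"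
        using Cons.prems by (intro foldr_cong) auto
      then show ?thesis
        using True Cons.prems f b
        by (simp add: foldr_partial_pow_commute funpow_swap1)
    qed (use Cons in auto)
  qed simp
  from this[of basis_list] show ?thesis
    unfolding mderiv_def using b by (simp add: basis_list)
qed

lemma mderiv_lincomb:
  assumes "smooth f" "smooth g"
  shows "mderiv \<alpha> (\<lambda>x. c * f x + d * g x) = (\<lambda>x. c * mderiv \<alpha> f x + d * mderiv \<alpha> g x)"
proof -
  have pow: "(partial b ^^ k) (\<lambda>x. c * f x + d * g x)
      = (\<lambda>x. c * (partial b ^^ k) f x + d * (partial b ^^ k) g x)"
    if "b \<in> Basis" "smooth f" "smooth g" for b :: 'a and k f g
    by (induction k) (use that in \<open>auto simp: partial_lincomb_smooth smooth_partial_pow\<close>)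
  have "foldr (\<lambda>b. partial b ^^ \<alpha> b) bs (\<lambda>x. c * f x + d * g x) = (\<lambda>x. c *
      foldr (\<lambda>b. partial b ^^ \<alpha> b) bs f x + d * foldr (\<lambda>b. partial b ^^ \<alpha> b) bs g x)"
    if "set bs \<subseteq> Basis" for bs
    using that
    by (induction bs) (use assms in \<open>auto simp: pow smooth_foldr_partial_pow\<close>)
  then show ?thesis unfolding mderiv_def by (simp add: basis_list)
qed

section \<open>The Schwartz space\<close>

lemma mderiv_0 [simp]: "mderiv (\<lambda>_. 0) f = f"
proof -
  have "foldr (\<lambda>b. partial b ^^ 0) bs f = f" for bs :: "'a list"
    by (induction bs) auto
  then show ?thesis by (simp add: mderiv_def)
qed

text \<open>A multi-index derivative as one list of single partial derivatives, the form in which derivatives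
are later moved under the integral sign by induction on the list.\<close>

lemma mderiv_eq_foldr_partial:
  fixes \<alpha> :: "'a::euclidean_space \<Rightarrow> nat"
  obtains bs where "bs \<in> lists Basis" "\<And>f. mderiv \<alpha> f = foldr partial bs f"
proof
  let ?bs = "concat (map (\<lambda>b. replicate (\<alpha> b) b) (basis_list :: 'a list))"
  show "?bs \<in> lists Basis" by (auto simp: basis_list)
  have "foldr (\<lambda>b. partial b ^^ \<alpha> b) bs f = foldr partial (concat (map (\<lambda>b. replicate (\<alpha> b) b) bs)) f"
    for bs and f :: "'a \<Rightarrow> complex"
    by (induction bs) (auto simp: foldr_replicate)
  then show "mderiv \<alpha> f = foldr partial ?bs f" for f
    unfolding mderiv_def .
qed

lemma schwartz_smooth: "f \<in> schwartz \<Longrightarrow> smooth f"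
  by (simp add: schwartz_def)

lemma schwartz_bdd_above:
  assumes "f \<in> schwartz"
  shows "bdd_above (range (\<lambda>x. norm (monomial \<alpha> x *\<^sub>R mderiv \<beta> f x)))"
proof -
  have "bounded (range (\<lambda>x. monomial \<alpha> x *\<^sub>R mderiv \<beta> f x))"
    using assms unfolding schwartz_def by blast
  then show ?thesis
    unfolding bounded_iff bdd_above_def by fastforce
qed

lemma le_schwartz_seminorm:
  assumes "f \<in> schwartz"
  shows "norm (monomial \<alpha> x *\<^sub>R mderiv \<beta> f x) \<le> schwartz_seminorm \<alpha> \<beta> f"
  unfolding schwartz_seminorm_def by (rule cSUP_upper[OF _ schwartz_bdd_above[OF assms]]) simp

lemma le_schwartz_seminorm0:
  assumes "f \<in> schwartz"
  shows "\<bar>monomial \<alpha> x\<bar> * norm (f x) \<le> schwartz_seminorm \<alpha> (\<lambda>_. 0) f"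
  using le_schwartz_seminorm[OF assms, of \<alpha> x "\<lambda>_. 0"] by simp

lemma schwartz_seminorm_nonneg: "f \<in> schwartz \<Longrightarrow> 0 \<le> schwartz_seminorm \<alpha> \<beta> f"
  by (rule order_trans[OF norm_ge_zero le_schwartz_seminorm])

lemma schwartz_seminorm_leI:
  assumes "\<And>x. norm (monomial \<alpha> x *\<^sub>R mderiv \<beta> f x) \<le> B"
  shows "schwartz_seminorm \<alpha> \<beta> f \<le> B"
  unfolding schwartz_seminorm_def by (rule cSUP_least) (use assms in auto)

lemma schwartzI:
  assumes "smooth f" "\<And>\<alpha> \<beta>. \<exists>B. \<forall>x. norm (monomial \<alpha> x *\<^sub>R mderiv \<beta> f x) \<le> B"
  shows "f \<in> schwartz"
  unfolding schwartz_def bounded_iff using assms by blast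

lemma
  assumes "f \<in> schwartz" "b \<in> Basis"
  shows schwartz_partial: "partial b f \<in> schwartz"
    and schwartz_seminorm_partial:
      "schwartz_seminorm \<alpha> \<beta> (partial b f) = schwartz_seminorm \<alpha> (\<beta>(b := Suc (\<beta> b))) f"
proof -
  note md = mderiv_partial[OF schwartz_smooth[OF assms(1)] assms(2)]
  show "partial b f \<in> schwartz"
  proof (rule schwartzI)
    show "smooth (partial b f)" using assms by (intro smooth_partial schwartz_smooth)
    show "\<exists>B. \<forall>x. norm (monomial \<alpha> x *\<^sub>R mderiv \<beta> (partial b f) x) \<le> B" for \<alpha> \<beta>
      unfolding md using le_schwartz_seminorm[OF assms(1)] by (intro exI allI)
  qed
  show "schwartz_seminorm \<alpha> \<beta> (partial b f) = schwartz_seminorm \<alpha> (\<beta>(b := Suc (\<beta> b))) f"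
    unfolding schwartz_seminorm_def md ..
qed

lemma
  assumes f: "f \<in> schwartz" and g: "g \<in> schwartz"
  shows schwartz_lincomb: "(\<lambda>x. c * f x + d * g x) \<in> schwartz"
    and schwartz_seminorm_lincomb: "schwartz_seminorm \<alpha> \<beta> (\<lambda>x. c * f x + d * g x)
      \<le> norm c * schwartz_seminorm \<alpha> \<beta> f + norm d * schwartz_seminorm \<alpha> \<beta> g"
proof -
  have bnd: "norm (monomial \<alpha> x *\<^sub>R mderiv \<beta> (\<lambda>x. c * f x + d * g x) x)
      \<le> norm c * schwartz_seminorm \<alpha> \<beta> f + norm d * schwartz_seminorm \<alpha> \<beta> g" for \<alpha> \<beta> x
  proof -
    have "monomial \<alpha> x *\<^sub>R mderiv \<beta> (\<lambda>x. c * f x + d * g x) x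
      = c * (monomial \<alpha> x *\<^sub>R mderiv \<beta> f x) + d * (monomial \<alpha> x *\<^sub>R mderiv \<beta> g x)"
      using mderiv_lincomb[OF f[THEN schwartz_smooth] g[THEN schwartz_smooth], of \<beta> c d]
      by (simp add: scaleR_add_right)
    also have "norm \<dots> \<le> norm c * norm (monomial \<alpha> x *\<^sub>R mderiv \<beta> f x)
        + norm d * norm (monomial \<alpha> x *\<^sub>R mderiv \<beta> g x)"
      by (rule order_trans[OF norm_triangle_ineq]) (simp only: norm_mult order_refl)
    also have "\<dots> \<le> norm c * schwartz_seminorm \<alpha> \<beta> f + norm d * schwartz_seminorm \<alpha> \<beta> g"
      by (intro add_mono mult_left_mono le_schwartz_seminorm f g norm_ge_zero)
    finally show ?thesis .
  qed
  show "(\<lambda>x. c * f x + d * g x) \<in> schwartz"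
  proof (rule schwartzI)
    show "smooth (\<lambda>x. c * f x + d * g x)"
      using f g by (intro smooth_lincomb schwartz_smooth)
    show "\<exists>B. \<forall>x. norm (monomial \<alpha> x *\<^sub>R mderiv \<beta> (\<lambda>x. c * f x + d * g x) x) \<le> B" for \<alpha> \<beta>
      using bnd[of \<alpha> _ \<beta>] by (intro exI allI)
  qed
  show "schwartz_seminorm \<alpha> \<beta> (\<lambda>x. c * f x + d * g x)
      \<le> norm c * schwartz_seminorm \<alpha> \<beta> f + norm d * schwartz_seminorm \<alpha> \<beta> g"
    using bnd by (rule schwartz_seminorm_leI)
qed

lemma schwartz_add: "f \<in> schwartz \<Longrightarrow> g \<in> schwartz \<Longrightarrow> (\<lambda>x. f x + g x) \<in> schwartz"
  using schwartz_lincomb[of f g 1 1] by simp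

lemma schwartz_diff: "f \<in> schwartz \<Longrightarrow> g \<in> schwartz \<Longrightarrow> (\<lambda>x. f x - g x) \<in> schwartz"
  using schwartz_lincomb[of f g 1 "-1"] by simp

lemma schwartz_seminorm_add: "f \<in> schwartz \<Longrightarrow> g \<in> schwartz \<Longrightarrow>
    schwartz_seminorm \<alpha> \<beta> (\<lambda>x. f x + g x) \<le> schwartz_seminorm \<alpha> \<beta> f + schwartz_seminorm \<alpha> \<beta> g"
  using schwartz_seminorm_lincomb[of f g \<alpha> \<beta> 1 1] by simp

section \<open>Continuity with respect to the Schwartz seminorms\<close>

text \<open>This is the usual continuity criterion for a seminorm \<open>p\<close> on the Schwartz space: a bound by a multiple
of a finite sum of the defining seminorms. Repetitions in the list do no harm, and lists make sums of
dominated functionals a matter of concatenation.\<close>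

definition seminorm_dominated :: "(('a::euclidean_space \<Rightarrow> complex) \<Rightarrow> real) \<Rightarrow> bool" where
  "seminorm_dominated p \<longleftrightarrow> (\<exists>C is. \<forall>f\<in>schwartz. p f \<le> C * (\<Sum>(\<alpha>, \<beta>)\<leftarrow>is. schwartz_seminorm \<alpha> \<beta> f))"

lemma seminorm_dominated_seminorm: "seminorm_dominated (schwartz_seminorm \<alpha> \<beta>)"
  unfolding seminorm_dominated_def by (intro exI[of _ 1] exI[of _ "[(\<alpha>, \<beta>)]"]) simp

lemma seminorm_dominated_mono: "seminorm_dominated q \<Longrightarrow> (\<And>f. f \<in> schwartz \<Longrightarrow> p f \<le> q f) \<Longrightarrow> seminorm_dominated p"
  unfolding seminorm_dominated_def by (meson order_trans)

lemma seminorm_dominated_cmult: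
  assumes "seminorm_dominated p" "0 \<le> c"
  shows "seminorm_dominated (\<lambda>f. c * p f)"
proof -
  obtain C "is" where "\<forall>f\<in>schwartz. p f \<le> C * (\<Sum>(\<alpha>, \<beta>)\<leftarrow>is. schwartz_seminorm \<alpha> \<beta> f)"
    using assms(1) unfolding seminorm_dominated_def by blast
  then have "\<forall>f\<in>schwartz. c * p f \<le> (c * C) * (\<Sum>(\<alpha>, \<beta>)\<leftarrow>is. schwartz_seminorm \<alpha> \<beta> f)"
    using assms(2) by (simp add: mult.assoc mult_left_mono)
  then show ?thesis unfolding seminorm_dominated_def by blast
qed

lemma seminorm_list_nonneg:
  "f \<in> schwartz \<Longrightarrow> 0 \<le> (\<Sum>(\<alpha>, \<beta>)\<leftarrow>is. schwartz_seminorm \<alpha> \<beta> f)"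
  by (rule sum_list_nonneg) (auto intro: schwartz_seminorm_nonneg)

lemma seminorm_dominated_add:
  assumes "seminorm_dominated p" "seminorm_dominated q"
  shows "seminorm_dominated (\<lambda>f. p f + q f)"
proof -
  let ?S = "\<lambda>is f. \<Sum>(\<alpha>, \<beta>)\<leftarrow>is. schwartz_seminorm \<alpha> \<beta> f"
  obtain C "is" where p: "\<And>f. f \<in> schwartz \<Longrightarrow> p f \<le> C * ?S is f"
    using assms(1) unfolding seminorm_dominated_def by blast
  obtain D js where q: "\<And>f. f \<in> schwartz \<Longrightarrow> q f \<le> D * ?S js f"
    using assms(2) unfolding seminorm_dominated_def by blast
  have "p f + q f \<le> max C D * ?S (is @ js) f" if f: "f \<in> schwartz" for f
  proof -
    have "p f + q f \<le> C * ?S is f + D * ?S js f" using p q f by (simp add: add_mono)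
    also have "\<dots> \<le> max C D * ?S is f + max C D * ?S js f"
      by (intro add_mono mult_right_mono seminorm_list_nonneg f) auto
    finally show ?thesis by (simp add: distrib_left)
  qed
  then show ?thesis unfolding seminorm_dominated_def by blast
qed

lemma seminorm_dominated_sum:
  assumes "finite A" "\<And>a. a \<in> A \<Longrightarrow> seminorm_dominated (p a)"
  shows "seminorm_dominated (\<lambda>f. \<Sum>a\<in>A. p a f)"
  using assms
proof (induction A)
  case empty
  show ?case unfolding seminorm_dominated_def by (intro exI[of _ 0]) simp
qed (simp add: seminorm_dominated_add)

lemma openin_schwartz_ball:
  assumes "f \<in> schwartz" "0 < e"
  shows "openin schwartz_topology {g \<in> schwartz. schwartz_seminorm \<alpha> \<beta> (\<lambda>x. g x - f x) < e}"
  unfolding schwartz_topology_def using assms by (intro topology_generated_by_Basis) blast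

text \<open>The neighbourhood is a finite intersection of subbasic balls about \<open>f\<close>; the \<open>+ 1\<close> terms in the radius
cover a vanishing constant and an empty list.\<close>

lemma seminorm_dominated_neighbourhood:
  fixes f :: "'a::euclidean_space \<Rightarrow> complex"
  assumes p: "seminorm_dominated p" and f: "f \<in> schwartz" and e: "0 < e"
  obtains U where "openin schwartz_topology U" "f \<in> U" "\<And>g. g \<in> U \<Longrightarrow> p (\<lambda>x. g x - f x) < e"
proof -
  let ?S = "\<lambda>is f. \<Sum>(\<alpha>, \<beta>)\<leftarrow>is. schwartz_seminorm \<alpha> \<beta> f"
  obtain C "is" where C: "\<And>f. f \<in> schwartz \<Longrightarrow> p f \<le> C * ?S is f"
    using p unfolding seminorm_dominated_def by blast
  define d where "d = e / ((\<bar>C\<bar> + 1) * (real (length is) + 1))"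
  have d: "d > 0" using e by (auto simp: d_def intro!: divide_pos_pos mult_pos_pos)
  define B where "B = (\<lambda>(\<alpha>, \<beta>). {g \<in> schwartz. schwartz_seminorm \<alpha> \<beta> (\<lambda>x. g x - f x) < d})"
  define U where "U = (\<Inter>i\<in>set is. B i) \<inter> topspace schwartz_topology"
  show thesis
  proof
    show "openin schwartz_topology U"
      unfolding U_def
      by (rule openin_INT) (auto simp: B_def intro!: openin_schwartz_ball f d)
    have "schwartz_seminorm \<alpha> \<beta> (\<lambda>x. f x - f x) = 0" for \<alpha> \<beta>
    proof -
      have "schwartz_seminorm \<alpha> \<beta> (\<lambda>x. f x - f x) \<le> 0"
        using schwartz_seminorm_lincomb[OF f f, of \<alpha> \<beta> 0 0] by simp
      with schwartz_seminorm_nonneg[OF schwartz_diff[OF f f]] show ?thesis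
        by (meson antisym)
    qed
    then show "f \<in> U" using f d by (auto simp: U_def B_def topspace_schwartz_topology)
    fix g assume "g \<in> U"
    then have g: "g \<in> schwartz"
      and gB: "\<And>\<alpha> \<beta>. (\<alpha>, \<beta>) \<in> set is \<Longrightarrow> schwartz_seminorm \<alpha> \<beta> (\<lambda>x. g x - f x) < d"
      by (auto simp: U_def B_def topspace_schwartz_topology)
    have "?S is (\<lambda>x. g x - f x) \<le> (\<Sum>i\<leftarrow>is. d)"
      by (rule sum_list_mono) (use gB in \<open>auto intro: less_imp_le\<close>)
    then have S: "?S is (\<lambda>x. g x - f x) \<le> real (length is) * d"
      by (simp add: sum_list_triv)
    have "p (\<lambda>x. g x - f x) \<le> C * ?S is (\<lambda>x. g x - f x)"
      by (rule C[OF schwartz_diff[OF g f]])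
    also have "\<dots> \<le> \<bar>C\<bar> * (real (length is) * d)"
      using S by (intro mult_mono seminorm_list_nonneg schwartz_diff g f) auto
    also have "\<dots> \<le> \<bar>C\<bar> * ((real (length is) + 1) * d)"
      by (rule mult_left_mono) (use d in simp_all)
    also have "\<dots> < (\<bar>C\<bar> + 1) * ((real (length is) + 1) * d)"
      by (rule mult_strict_right_mono) (use d in simp_all)
    also have "\<dots> = e" by (simp add: d_def)
    finally show "p (\<lambda>x. g x - f x) < e" .
  qed
qed

text \<open>Only differences of values of \<open>L\<close> have to be estimated, so that \<open>L\<close> may be given by a formula that is
meaningful merely on \<open>S\<close>. The subbasic balls in the target have arbitrary centres \<open>h\<close>; the triangle
inequality reduces them to balls about a point of the image.\<close>

lemma continuous_map_schwartzI:
  fixes L :: "('a::euclidean_space \<Rightarrow> complex) \<Rightarrow> 'b::euclidean_space \<Rightarrow> complex"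
  assumes S: "S \<subseteq> schwartz" and L: "\<And>f. f \<in> S \<Longrightarrow> L f \<in> schwartz"
    and bnd: "\<And>\<alpha> \<beta>. \<exists>p. seminorm_dominated p \<and> (\<forall>f\<in>S. \<forall>g\<in>S.
      schwartz_seminorm \<alpha> \<beta> (\<lambda>x. L g x - L f x) \<le> p (\<lambda>z. g z - f z))"
  shows "continuous_map (subtopology schwartz_topology S) schwartz_topology L"
proof -
  let ?T = "subtopology schwartz_topology S"
  have top: "topspace ?T = S" using S by (auto simp: topspace_schwartz_topology)
  have pre: "openin ?T (L -` {g \<in> schwartz. schwartz_seminorm \<alpha> \<beta> (\<lambda>x. g x - h x) < e} \<inter> topspace ?T)"
    (is "openin ?T ?V")
    if h: "h \<in> schwartz" for \<alpha> \<beta> h e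
  proof (subst openin_subopen, intro ballI)
    fix f assume fV: "f \<in> ?V"
    then have f: "f \<in> S" and less: "schwartz_seminorm \<alpha> \<beta> (\<lambda>x. L f x - h x) < e"
      by (auto simp: top)
    obtain p where p: "seminorm_dominated p" and pL: "\<And>f g. f \<in> S \<Longrightarrow> g \<in> S \<Longrightarrow>
        schwartz_seminorm \<alpha> \<beta> (\<lambda>x. L g x - L f x) \<le> p (\<lambda>z. g z - f z)"
      using bnd by blast
    obtain U where U: "openin schwartz_topology U" "f \<in> U" and
      Up: "\<And>g. g \<in> U \<Longrightarrow> p (\<lambda>x. g x - f x) < e - schwartz_seminorm \<alpha> \<beta> (\<lambda>x. L f x - h x)"
      using seminorm_dominated_neighbourhood[OF p, of f "e - schwartz_seminorm \<alpha> \<beta> (\<lambda>x. L f x - h x)"]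
        f less S by auto
    have "U \<inter> S \<subseteq> ?V"
    proof
      fix g assume g: "g \<in> U \<inter> S"
      have "schwartz_seminorm \<alpha> \<beta> (\<lambda>x. L g x - h x)
          = schwartz_seminorm \<alpha> \<beta> (\<lambda>x. (L g x - L f x) + (L f x - h x))" by simp
      also have "\<dots> \<le> schwartz_seminorm \<alpha> \<beta> (\<lambda>x. L g x - L f x)
          + schwartz_seminorm \<alpha> \<beta> (\<lambda>x. L f x - h x)"
        using f g h by (intro schwartz_seminorm_add schwartz_diff L) auto
      also have "\<dots> < e" using pL[OF f, of g] Up[of g] g by simp
      finally show "g \<in> ?V" using g L top by auto
    qed
    then show "\<exists>W. openin ?T W \<and> f \<in> W \<and> W \<subseteq> ?V"
      using U f by (intro exI[of _ "U \<inter> S"]) (auto simp: openin_subtopology)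
  qed
  show ?thesis
    unfolding schwartz_topology_def[where 'a = 'b]
  proof (rule continuous_on_generated_topo)
    have "L ` topspace ?T \<subseteq> topspace schwartz_topology"
      unfolding top topspace_schwartz_topology using L by blast
    then show "L ` topspace ?T \<subseteq> \<Union> {{g \<in> schwartz. schwartz_seminorm \<alpha> \<beta> (\<lambda>x. g x - f x) < \<epsilon>} | f \<alpha> \<beta> \<epsilon>.
        f \<in> schwartz \<and> \<epsilon> > 0}"
      unfolding schwartz_topology_def topology_generated_by_topspace .
  qed (use pre in auto)
qed

section \<open>Integrability of the regularised kernel\<close>

text \<open>The kernel $|h|^{-n-1/2}$ of the half-divergence, multiplied by the factor $\min(1,|h|)$ which
functions vanishing on the diagonal contribute. That factor turns the exponent at the origin
into $-n+1/2$, which is integrable, while $-n-1/2$ is integrable at infinity.\<close>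

definition offset_kernel :: "'a::euclidean_space \<Rightarrow> real" where
  "offset_kernel h = min 1 (norm h) / (sqrt (norm h) * norm h ^ DIM('a))"

lemma dyadic_bracket:
  fixes r :: real
  assumes "1 \<le> r"
  obtains k :: nat where "2 ^ k \<le> r" "r \<le> 2 ^ Suc k"
proof -
  obtain m where "r < 2 ^ m" using real_arch_pow[of 2 r] by auto
  then have L: "r < 2 ^ (LEAST m. r < 2 ^ m)" by (rule LeastI)
  moreover have "(LEAST m. r < 2 ^ m) \<noteq> 0" using L assms by (intro notI) simp
  then obtain k where k: "(LEAST m. r < 2 ^ m) = Suc k" using not0_implies_Suc by blast
  moreover have "\<not> r < 2 ^ k" using not_less_Least[of k "\<lambda>m. r < 2 ^ m"] k by simp
  ultimately show thesis using that[of k] by auto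
qed

lemma offset_kernel_small:
  fixes h :: "'a::euclidean_space"
  assumes "(1/2) ^ Suc k \<le> norm h" "norm h \<le> (1/2) ^ k"
  shows "offset_kernel h \<le> (1 / sqrt 2) ^ k * (2 ^ Suc k) ^ DIM('a)"
proof -
  have pos: "norm h > 0" using assms(1) by (rule less_le_trans[rotated]) simp
  have le1: "norm h \<le> 1" using assms(2) by (rule order_trans) (simp add: power_le_one)
  have "offset_kernel h = sqrt (norm h) * (1 / norm h) ^ DIM('a)"
    using pos le1 real_sqrt_mult_self[of "norm h"]
    by (simp add: offset_kernel_def min_def power_divide field_simps)
  also have "\<dots> \<le> sqrt ((1/2) ^ k) * (2 ^ Suc k) ^ DIM('a)"
  proof (intro mult_mono power_mono real_sqrt_le_mono assms)
    show "1 / norm h \<le> 2 ^ Suc k" using assms(1) pos by (simp add: field_simps)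
  qed auto
  also have "sqrt ((1/2) ^ k) = (1 / sqrt 2) ^ k"
    by (simp add: real_sqrt_power real_sqrt_divide)
  finally show ?thesis .
qed

lemma offset_kernel_large:
  fixes h :: "'a::euclidean_space"
  assumes "2 ^ k \<le> norm h"
  shows "offset_kernel h \<le> (1 / sqrt 2) ^ k * (1 / 2 ^ k) ^ DIM('a)"
proof -
  have ge: "1 \<le> norm h" using assms by (rule order_trans[rotated]) simp
  have "offset_kernel h = 1 / sqrt (norm h) * (1 / norm h) ^ DIM('a)"
    using ge by (simp add: offset_kernel_def min_def power_divide)
  also have "\<dots> \<le> 1 / sqrt (2 ^ k) * (1 / 2 ^ k) ^ DIM('a)"
    using ge assms by (intro mult_mono power_mono divide_left_mono) (auto intro!: mult_pos_pos)
  also have "1 / sqrt (2 ^ k) = (1 / sqrt 2) ^ k"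
    by (simp add: real_sqrt_power power_divide)
  finally show ?thesis .
qed

lemma offset_kernel_nonneg: "0 \<le> offset_kernel h"
  by (simp add: offset_kernel_def)

lemma offset_kernel_measurable [measurable]: "offset_kernel \<in> borel_measurable borel"
  unfolding offset_kernel_def by measurable

text \<open>Cover the punctured space by dyadic shells. On the shell at distance about $2^{-k}$, and likewise on
the one at distance about $2^k$, the supremum of the kernel times the volume of the enclosing ball is
at most $V 2^n 2^{-k/2}$ with $V$ the volume of the unit ball, which is a geometric series.\<close>

lemma integrable_offset_kernel: "integrable lborel (offset_kernel :: 'a::euclidean_space \<Rightarrow> real)"
proof (rule integrableI_nonneg)
  let ?n = "DIM('a)" and ?V = "unit_ball_vol DIM('a)"
  define q :: real where "q = 1 / sqrt 2"
  have q: "0 < q" "q < 1" by (auto simp: q_def)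
  define F :: "nat \<Rightarrow> 'a \<Rightarrow> ennreal" where "F k h =
      ennreal (q ^ k * (2 ^ Suc k) ^ ?n) * indicator (cball 0 ((1/2) ^ k)) h
    + ennreal (q ^ k * (1 / 2 ^ k) ^ ?n) * indicator (cball 0 (2 ^ Suc k)) h" for k h
  have F_meas [measurable]: "F k \<in> borel_measurable lborel" for k
    unfolding F_def by (intro borel_measurable_add borel_measurable_times_ennreal
      borel_measurable_indicator) simp_all
  have "ennreal (offset_kernel h) \<le> (\<Sum>k. F k h)" for h :: 'a
  proof -
    consider "h = 0" | "0 < norm h" "norm h \<le> 1" | "1 \<le> norm h" by fastforce
    \<comment> \<open>At \<open>h = 0\<close> the kernel is \<open>0\<close>, since division by zero gives zero.\<close>
    then have "\<exists>k. ennreal (offset_kernel h) \<le> F k h"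
    proof cases
      case 1
      then show ?thesis by (simp add: offset_kernel_def)
    next
      case 2
      then obtain k where "2 ^ k \<le> 1 / norm h" "1 / norm h \<le> 2 ^ Suc k"
        using dyadic_bracket[of "1 / norm h"] by auto
      then have k: "(1/2) ^ Suc k \<le> norm h" "norm h \<le> (1/2) ^ k"
        using 2 by (auto simp: field_simps)
      have "ennreal (offset_kernel h) \<le> ennreal (q ^ k * (2 ^ Suc k) ^ ?n)"
        using offset_kernel_small[OF k] unfolding q_def by (rule ennreal_leI)
      also have "\<dots> \<le> F k h" using k(2) by (simp add: F_def)
      finally show ?thesis ..
    next
      case 3
      then obtain k where k: "2 ^ k \<le> norm h" "norm h \<le> 2 ^ Suc k"
        by (rule dyadic_bracket)
      have "ennreal (offset_kernel h) \<le> ennreal (q ^ k * (1 / 2 ^ k) ^ ?n)"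
        using offset_kernel_large[OF k(1)] unfolding q_def by (rule ennreal_leI)
      also have "\<dots> \<le> F k h" using k(2) by (simp add: F_def)
      finally show ?thesis ..
    qed
    then obtain k where "ennreal (offset_kernel h) \<le> F k h" ..
    also have "\<dots> = (\<Sum>j\<in>{k}. F j h)" by simp
    also have "\<dots> \<le> (\<Sum>j. F j h)" by (rule sum_le_suminf) auto
    finally show ?thesis .
  qed
  then have "(\<integral>\<^sup>+ h. ennreal (offset_kernel (h :: 'a)) \<partial>lborel) \<le> (\<integral>\<^sup>+ h. (\<Sum>k. F k h) \<partial>lborel)"
    by (intro nn_integral_mono)
  also have "\<dots> = (\<Sum>k. \<integral>\<^sup>+ h. F k h \<partial>lborel)"
    by (rule nn_integral_suminf) simp
  also have "\<dots> = (\<Sum>k. ennreal (2 * ?V * 2 ^ ?n * q ^ k))"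
  proof (rule suminf_cong)
    fix k
    have "(\<integral>\<^sup>+ h. F k h \<partial>lborel)
        = ennreal (q ^ k * (2 ^ Suc k) ^ ?n) * ennreal (?V * ((1/2) ^ k) ^ ?n)
        + ennreal (q ^ k * (1 / 2 ^ k) ^ ?n) * ennreal (?V * (2 ^ Suc k) ^ ?n)"
      unfolding F_def
      by (subst nn_integral_add)
        (simp_all add: nn_integral_cmult_indicator emeasure_cball borel_measurable_times_ennreal
          borel_measurable_indicator)
    also have "\<dots> = ennreal (q ^ k * (2 ^ Suc k) ^ ?n * (?V * ((1/2) ^ k) ^ ?n)
        + q ^ k * (1 / 2 ^ k) ^ ?n * (?V * (2 ^ Suc k) ^ ?n))"
      using q by (subst ennreal_plus) (auto simp: ennreal_mult)
    also have "q ^ k * (2 ^ Suc k) ^ ?n * (?V * ((1/2) ^ k) ^ ?n)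
        + q ^ k * (1 / 2 ^ k) ^ ?n * (?V * (2 ^ Suc k) ^ ?n) = 2 * ?V * 2 ^ ?n * q ^ k"
    proof -
      have 1: "((2::real) ^ Suc k) ^ ?n * ((1/2) ^ k) ^ ?n = 2 ^ ?n"
        unfolding power_mult_distrib[symmetric] by (simp add: power_divide)
      have 2: "(1 / (2::real) ^ k) ^ ?n * (2 ^ Suc k) ^ ?n = 2 ^ ?n"
        unfolding power_mult_distrib[symmetric] by simp
      have "p * a * (v * b) + p * c * (v * d) = 2 * v * e * p"
        if "a * b = e" "c * d = e" for p a b c d e v :: real
      proof -
        have "p * a * (v * b) + p * c * (v * d) = p * v * (a * b) + p * v * (c * d)"
          by (simp add: mult_ac)
        with that show ?thesis by simp
      qed
      from this[OF 1 2] show ?thesis .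
    qed
    finally show "(\<integral>\<^sup>+ h. F k h \<partial>lborel) = ennreal (2 * ?V * 2 ^ ?n * q ^ k)" .
  qed
  also have "\<dots> < \<infinity>"
  proof (subst suminf_ennreal2)
    show "summable (\<lambda>k. 2 * ?V * 2 ^ ?n * q ^ k)"
      using q by (intro summable_mult summable_geometric) simp
  qed (use q in simp_all)
  finally show "(\<integral>\<^sup>+ h. ennreal (offset_kernel (h :: 'a)) \<partial>lborel) < \<infinity>" .
qed (auto simp: offset_kernel_nonneg)

section \<open>Derivatives and decay near the diagonal\<close>

text \<open>Antisymmetry already forces \<open>G (x, x) = 0\<close>, and it survives the derivatives \<open>diagonal_partial\<close>
below, so derivatives of the half-divergence are half-divergences of functions from the same
space.\<close>

definition antisym_schwartz :: "('a::euclidean_space \<times> 'a \<Rightarrow> complex) set" where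
  "antisym_schwartz = {G \<in> schwartz. \<forall>x y. G (x, y) = - G (y, x)}"

text \<open>The derivative in the direction \<open>(b, b)\<close>. It is a sum of two coordinate derivatives so
that the stability of the Schwartz space under \<open>partial\<close> applies to it directly.\<close>

definition diagonal_partial ::
    "'a::euclidean_space \<Rightarrow> ('a \<times> 'a \<Rightarrow> complex) \<Rightarrow> 'a \<times> 'a \<Rightarrow> complex" where
  "diagonal_partial b G z = partial (b, 0) G z + partial (0, b) G z"

lemma Pair_Basis: "b \<in> Basis \<Longrightarrow> (b, 0) \<in> Basis" "b \<in> Basis \<Longrightarrow> (0, b) \<in> Basis"
  by (auto simp: Basis_prod_def)

lemma schwartz_diagonal_partial:
  "G \<in> schwartz \<Longrightarrow> b \<in> Basis \<Longrightarrow> diagonal_partial b G \<in> schwartz"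
  unfolding diagonal_partial_def[abs_def] by (intro schwartz_add schwartz_partial Pair_Basis)

lemma schwartz_seminorm_diagonal_partial:
  assumes "G \<in> schwartz" "b \<in> Basis"
  shows "schwartz_seminorm \<alpha> \<beta> (diagonal_partial b G)
    \<le> schwartz_seminorm \<alpha> (\<beta>((b, 0) := Suc (\<beta> (b, 0)))) G
      + schwartz_seminorm \<alpha> (\<beta>((0, b) := Suc (\<beta> (0, b)))) G"
  using schwartz_seminorm_add[of "partial (b, 0) G" "partial (0, b) G"] assms
  by (simp add: diagonal_partial_def[abs_def] schwartz_partial schwartz_seminorm_partial Pair_Basis)

text \<open>Differentiate the identity \<open>G (x, y) = - G (y, x)\<close> along the direction \<open>(u, v)\<close>.\<close>

lemma partial_swap_antisym:
  fixes G :: "'a::euclidean_space \<times> 'a \<Rightarrow> complex"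
  assumes smooth: "smooth G" and anti: "\<And>x y. G (x, y) = - G (y, x)"
  shows "partial (u, v) G (x, y) = - partial (v, u) G (y, x)"
proof -
  have "((\<lambda>t. G ((y, x) + t *\<^sub>R (v, u))) has_vector_derivative partial (v, u) G (y, x)) (at 0)"
    using has_vector_derivative_partial[of G "(y, x)" 0 "(v, u)"] smooth_differentiable[OF smooth]
    by simp
  then have "((\<lambda>t. - G ((y, x) + t *\<^sub>R (v, u))) has_vector_derivative
      - partial (v, u) G (y, x)) (at 0)"
    by (rule has_vector_derivative_minus)
  moreover have "(\<lambda>t. - G ((y, x) + t *\<^sub>R (v, u))) = (\<lambda>t. G ((x, y) + t *\<^sub>R (u, v)))"
    using anti[of "x + _ *\<^sub>R u" "y + _ *\<^sub>R v"] by simp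
  ultimately show ?thesis
    unfolding partial_def[of "(u, v)"] by (simp add: vector_derivative_at)
qed

lemma antisym_schwartz_diagonal_partial:
  assumes "G \<in> antisym_schwartz" "b \<in> Basis"
  shows "diagonal_partial b G \<in> antisym_schwartz"
proof -
  have G: "G \<in> schwartz" "\<And>x y. G (x, y) = - G (y, x)"
    using assms(1) unfolding antisym_schwartz_def by blast+
  note swap = partial_swap_antisym[OF schwartz_smooth[OF G(1)] G(2)]
  have "diagonal_partial b G (x, y) = - diagonal_partial b G (y, x)" for x y
    unfolding diagonal_partial_def by (simp add: swap[of _ _ x y])
  with schwartz_diagonal_partial[OF G(1) assms(2)] show ?thesis
    unfolding antisym_schwartz_def by blast
qed

lemma antisym_schwartz_diff:
  "G \<in> antisym_schwartz \<Longrightarrow> H \<in> antisym_schwartz \<Longrightarrow> (\<lambda>z. G z - H z) \<in> antisym_schwartz"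
  unfolding antisym_schwartz_def
proof (intro CollectI conjI allI; elim CollectE conjE)
  assume G: "\<forall>x y. G (x, y) = - G (y, x)" and H: "\<forall>x y. H (x, y) = - H (y, x)"
  show "G (x, y) - H (x, y) = - (G (y, x) - H (y, x))" for x y
    using G[rule_format, of x y] H[rule_format, of x y] by simp
qed (rule schwartz_diff)

text \<open>With the offset \<open>h\<close> held fixed, moving \<open>x\<close> moves the point \<open>(x, x + h)\<close> parallel to the diagonal.\<close>

lemma has_derivative_along_diagonal:
  assumes "G differentiable (at (x, x + h))"
  shows "((\<lambda>x. G (x, x + h)) has_derivative
    (\<lambda>v. \<Sum>b\<in>Basis. (v \<bullet> b) *\<^sub>R diagonal_partial b G (x, x + h))) (at x)"
proof -
  obtain D where D: "(G has_derivative D) (at (x, x + h))"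
    using assms by (auto simp: differentiable_def)
  interpret D: bounded_linear D using D by (rule has_derivative_bounded_linear)
  have "((\<lambda>x. G (x, x + h)) has_derivative (\<lambda>v. D (v, v))) (at x)"
    by (rule has_derivative_compose[where f = "\<lambda>x. (x, x + h)" and g = G])
      (auto intro!: derivative_eq_intros D)
  moreover have "D (v, v) = (\<Sum>b\<in>Basis. (v \<bullet> b) *\<^sub>R diagonal_partial b G (x, x + h))" for v
  proof -
    have "(v, v) = (\<Sum>b\<in>Basis. (v \<bullet> b) *\<^sub>R (b, b))"
      by (simp add: prod_eq_iff fst_sum snd_sum euclidean_representation)
    then have "D (v, v) = (\<Sum>b\<in>Basis. (v \<bullet> b) *\<^sub>R D ((b, 0) + (0, b)))"
      by (simp add: D.sum D.scaleR flip: scaleR_Pair)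
    then show ?thesis
      unfolding D.add by (simp add: diagonal_partial_def has_derivative_partial_eq[OF D])
  qed
  ultimately show ?thesis by simp
qed

text \<open>A weight in \<open>x\<close> alone, read as a multi-index on the product space; the basis vectors of the first
factor are those with second component \<open>0\<close>.\<close>

definition lift_index :: "('a::euclidean_space \<Rightarrow> nat) \<Rightarrow> 'a \<times> 'a \<Rightarrow> nat" where
  "lift_index \<alpha> c = (if snd c = 0 then \<alpha> (fst c) else 0)"

lemma monomial_lift_index: "monomial (lift_index \<alpha>) (x, y) = monomial \<alpha> x"
proof -
  have "monomial (lift_index \<alpha>) (x, y)
      = (\<Prod>c\<in>(\<lambda>u. (u, 0)) ` Basis. ((x, y) \<bullet> c) ^ lift_index \<alpha> c)"
    unfolding monomial_def Basis_prod_def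
    by (rule prod.mono_neutral_right) (auto simp: lift_index_def)
  also have "\<dots> = monomial \<alpha> x"
    by (subst prod.reindex) (auto simp: inj_on_def monomial_def lift_index_def)
  finally show ?thesis .
qed

definition diagonal_bound :: "('a::euclidean_space \<Rightarrow> nat) \<Rightarrow> ('a \<times> 'a \<Rightarrow> complex) \<Rightarrow> real" where
  "diagonal_bound \<alpha> G = schwartz_seminorm (lift_index \<alpha>) (\<lambda>_. 0) G
     + (\<Sum>b\<in>Basis. schwartz_seminorm (lift_index \<alpha>) (\<lambda>_. 0) (partial (0, b) G))"

text \<open>For large \<open>h\<close> this is just a Schwartz seminorm of \<open>G\<close>. For small \<open>h\<close> apply the mean value inequality
in the second variable, starting from \<open>G (x, x) = 0\<close>; the weight depends on \<open>x\<close> only and is a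
constant there.\<close>

lemma antisym_schwartz_near_diagonal:
  fixes G :: "'a::euclidean_space \<times> 'a \<Rightarrow> complex"
  assumes "G \<in> antisym_schwartz"
  shows "\<bar>monomial \<alpha> x\<bar> * norm (G (x, x + h)) \<le> diagonal_bound \<alpha> G * min 1 (norm h)"
proof -
  have G: "G \<in> schwartz" and anti: "\<And>x y. G (x, y) = - G (y, x)"
    using assms unfolding antisym_schwartz_def by blast+
  let ?s = "schwartz_seminorm (lift_index \<alpha>) (\<lambda>_. 0)"
  define S where "S = (\<Sum>b\<in>Basis. ?s (partial (0, b) G))"
  have S: "0 \<le> S" unfolding S_def
    using G by (intro sum_nonneg schwartz_seminorm_nonneg schwartz_partial Pair_Basis)
  have far: "\<bar>monomial \<alpha> x\<bar> * norm (G (x, x + h)) \<le> ?s G"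
    using le_schwartz_seminorm0[OF G, of "lift_index \<alpha>" "(x, x + h)"]
    by (simp add: monomial_lift_index)
  have "norm (monomial \<alpha> x *\<^sub>R G (x, x + h) - monomial \<alpha> x *\<^sub>R G (x, x)) \<le> S * norm (x + h - x)"
  proof (rule differentiable_bound[of UNIV])
    fix y
    let ?D = "\<lambda>v. monomial \<alpha> x *\<^sub>R (\<Sum>b\<in>Basis. (v \<bullet> b) *\<^sub>R partial (0, b) G (x, y))"
    obtain D where D: "(G has_derivative D) (at (x, y))"
      using smooth_differentiable[OF schwartz_smooth[OF G]] by (auto simp: differentiable_def)
    interpret D: bounded_linear D using D by (rule has_derivative_bounded_linear)
    have "((\<lambda>y. G (x, y)) has_derivative (\<lambda>v. D (0, v))) (at y)"
      by (rule has_derivative_compose[where f = "\<lambda>y. (x, y)" and g = G])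
        (auto intro!: derivative_eq_intros D)
    moreover have "D (0, v) = (\<Sum>b\<in>Basis. (v \<bullet> b) *\<^sub>R partial (0, b) G (x, y))" for v
    proof -
      have "(0 :: 'a, v) = (\<Sum>b\<in>Basis. (v \<bullet> b) *\<^sub>R (0, b))"
        by (simp add: prod_eq_iff fst_sum snd_sum euclidean_representation)
      then show ?thesis
        by (simp add: D.sum D.scaleR has_derivative_partial_eq[OF D] flip: scaleR_Pair)
    qed
    ultimately show "((\<lambda>y. monomial \<alpha> x *\<^sub>R G (x, y)) has_derivative ?D) (at y within UNIV)"
      by (auto intro!: has_derivative_scaleR_right)
    show "onorm ?D \<le> S"
    proof (rule onorm_le)
      fix v :: 'a
      have "norm (?D v) \<le> \<bar>monomial \<alpha> x\<bar> * (\<Sum>b\<in>Basis. norm ((v \<bullet> b) *\<^sub>R partial (0, b) G (x, y)))"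
        unfolding norm_scaleR[of "monomial \<alpha> x"] by (intro mult_left_mono norm_sum) auto
      also have "\<dots> = (\<Sum>b\<in>Basis. \<bar>v \<bullet> b\<bar> * (\<bar>monomial \<alpha> x\<bar> * norm (partial (0, b) G (x, y))))"
        by (simp add: sum_distrib_left mult_ac)
      also have "\<dots> \<le> (\<Sum>b\<in>Basis. norm v * ?s (partial (0, b) G))"
      proof (intro sum_mono mult_mono)
        fix b :: 'a assume b: "b \<in> Basis"
        show "\<bar>v \<bullet> b\<bar> \<le> norm v" using b by (rule Basis_le_norm)
        show "\<bar>monomial \<alpha> x\<bar> * norm (partial (0, b) G (x, y)) \<le> ?s (partial (0, b) G)"
          using le_schwartz_seminorm0[OF schwartz_partial[OF G Pair_Basis(2)[OF b]],
            of "lift_index \<alpha>" "(x, y)"]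
          by (simp add: monomial_lift_index)
      qed auto
      also have "\<dots> = S * norm v" by (simp add: S_def sum_distrib_left mult.commute)
      finally show "norm (?D v) \<le> S * norm v" .
    qed
  qed auto
  moreover have "G (x, x) = 0" using anti[of x x] by simp
  ultimately have near: "\<bar>monomial \<alpha> x\<bar> * norm (G (x, x + h)) \<le> S * norm h" by simp
  have "\<bar>monomial \<alpha> x\<bar> * norm (G (x, x + h)) \<le> min (?s G) (S * norm h)"
    using near far by simp
  also have "\<dots> \<le> (?s G + S) * min 1 (norm h)"
  proof (cases "norm h \<le> 1")
    case True
    have "0 \<le> ?s G * norm h" by (simp add: schwartz_seminorm_nonneg G)
    with True show ?thesis by (simp add: distrib_right min_le_iff_disj)
  qed (use S in \<open>simp add: min_le_iff_disj\<close>)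
  finally show ?thesis unfolding diagonal_bound_def S_def .
qed

section \<open>The half-divergence in the offset variable\<close>

text \<open>The integrand of the half-divergence after the substitution \<open>y = x + h\<close>. The kernel now depends on the
integration variable alone, so that derivatives in \<open>x\<close> fall on \<open>G\<close> and never on the singularity.\<close>

definition offset_integrand :: "('a::euclidean_space \<times> 'a \<Rightarrow> complex) \<Rightarrow> 'a \<Rightarrow> 'a \<Rightarrow> complex" where
  "offset_integrand G x h =
     2 * G (x, x + h) / of_real (norm h powr (1/2)) / of_real (norm h ^ DIM('a))"

definition offset_div :: "('a::euclidean_space \<times> 'a \<Rightarrow> complex) \<Rightarrow> 'a \<Rightarrow> complex" where
  "offset_div G x = (LINT h|lborel. offset_integrand G x h)"

lemma offset_integrand_bound:
  fixes G :: "'a::euclidean_space \<times> 'a \<Rightarrow> complex"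
  assumes "G \<in> antisym_schwartz"
  shows "norm (monomial \<alpha> x *\<^sub>R offset_integrand G x h) \<le> 2 * diagonal_bound \<alpha> G * offset_kernel h"
proof -
  have "norm (monomial \<alpha> x *\<^sub>R offset_integrand G x h)
      = 2 * (\<bar>monomial \<alpha> x\<bar> * norm (G (x, x + h))) / (sqrt (norm h) * norm h ^ DIM('a))"
    by (simp add: offset_integrand_def norm_mult norm_divide norm_power powr_half_sqrt)
  also have "\<dots> \<le> 2 * (diagonal_bound \<alpha> G * min 1 (norm h)) / (sqrt (norm h) * norm h ^ DIM('a))"
    by (intro divide_right_mono mult_left_mono antisym_schwartz_near_diagonal assms) auto
  finally show ?thesis by (simp add: offset_kernel_def mult_ac)
qed

lemma monomial_0 [simp]: "monomial (\<lambda>_. 0) x = 1"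
  by (simp add: monomial_def)

lemma schwartz_continuous:
  assumes "G \<in> schwartz"
  shows "continuous_on UNIV G"
  using schwartz_smooth[OF assms]
  by (intro continuous_at_imp_continuous_on ballI differentiable_imp_continuous_within
      smooth_differentiable)

lemma offset_integrand_measurable:
  assumes "G \<in> schwartz"
  shows "offset_integrand G x \<in> borel_measurable borel"
proof -
  have "continuous_on UNIV (\<lambda>h. G (x, x + h))"
    by (rule continuous_on_compose2[OF schwartz_continuous[OF assms]]) (auto intro!: continuous_intros)
  then have [measurable]: "(\<lambda>h. G (x, x + h)) \<in> borel_measurable borel"
    by (rule borel_measurable_continuous_onI)
  show ?thesis unfolding offset_integrand_def[abs_def] by measurable
qed

lemma antisym_schwartzD: "G \<in> antisym_schwartz \<Longrightarrow> G \<in> schwartz"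
  by (simp add: antisym_schwartz_def)

lemma integrable_offset_integrand:
  fixes G :: "'a::euclidean_space \<times> 'a \<Rightarrow> complex"
  assumes "G \<in> antisym_schwartz"
  shows "integrable lborel (offset_integrand G x)"
proof (rule Bochner_Integration.integrable_bound)
  show "integrable lborel (\<lambda>h::'a. 2 * diagonal_bound (\<lambda>_. 0) G * offset_kernel h)"
    by (intro integrable_mult_right integrable_offset_kernel)
  show "offset_integrand G x \<in> borel_measurable lborel"
    using offset_integrand_measurable[OF antisym_schwartzD[OF assms]] by simp
  show "AE h in lborel. norm (offset_integrand G x h) \<le> norm (2 * diagonal_bound (\<lambda>_. 0) G * offset_kernel h)"
    using offset_integrand_bound[OF assms, of "\<lambda>_. 0" x]
    by (intro AE_I2) (simp add: order_trans[OF _ abs_ge_self])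
qed

lemma offset_div_diff:
  assumes "G \<in> antisym_schwartz" "H \<in> antisym_schwartz"
  shows "offset_div (\<lambda>z. G z - H z) = (\<lambda>x. offset_div G x - offset_div H x)"
proof
  fix x
  have "offset_integrand (\<lambda>z. G z - H z) x = (\<lambda>h. offset_integrand G x h - offset_integrand H x h)"
    by (simp add: offset_integrand_def fun_eq_iff diff_divide_distrib right_diff_distrib)
  then show "offset_div (\<lambda>z. G z - H z) x = offset_div G x - offset_div H x"
    unfolding offset_div_def
    by (simp add: Bochner_Integration.integral_diff integrable_offset_integrand assms)
qed

lemma offset_div_bound:
  fixes G :: "'a::euclidean_space \<times> 'a \<Rightarrow> complex"
  assumes "G \<in> antisym_schwartz"
  shows "norm (monomial \<alpha> x *\<^sub>R offset_div G x)
    \<le> 2 * (LINT h|lborel. offset_kernel (h::'a)) * diagonal_bound \<alpha> G"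
proof -
  have "norm (monomial \<alpha> x *\<^sub>R offset_div G x) = norm (LINT h|lborel. monomial \<alpha> x *\<^sub>R offset_integrand G x h)"
    unfolding offset_div_def integral_scaleR_right ..
  also have "\<dots> \<le> (LINT h|lborel. 2 * diagonal_bound \<alpha> G * offset_kernel (h::'a))"
  proof (rule Bochner_Integration.integral_norm_bound_integral)
    show "integrable lborel (\<lambda>h. monomial \<alpha> x *\<^sub>R offset_integrand G x h)"
      using assms by (intro integrable_scaleR_right integrable_offset_integrand)
    show "integrable lborel (\<lambda>h::'a. 2 * diagonal_bound \<alpha> G * offset_kernel h)"
      by (intro integrable_mult_right integrable_offset_kernel)
  qed (rule offset_integrand_bound[OF assms])
  finally show ?thesis by (simp add: mult_ac)
qed

lemma has_derivative_offset_integrand: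
  assumes "G \<in> schwartz"
  shows "((\<lambda>x. offset_integrand G x h) has_derivative
    (\<lambda>v. \<Sum>b\<in>Basis. (v \<bullet> b) *\<^sub>R offset_integrand (diagonal_partial b G) x h)) (at x)"
proof -
  define k :: complex where
    "k = 2 / of_real (norm h powr (1/2)) / of_real (norm h ^ DIM('a))"
  have k: "offset_integrand F y h = k * F (y, y + h)" for F y
    by (simp add: offset_integrand_def k_def)
  show ?thesis
    unfolding k using smooth_differentiable[OF schwartz_smooth[OF assms]]
    by (auto intro!: has_derivative_eq_rhs[OF has_derivative_mult_right
          [OF has_derivative_along_diagonal]] simp: sum_distrib_left)
qed

text \<open>Differentiation under the integral. The integrand of the derivative belongs to functions
\<open>diagonal_partial b G\<close>, again antisymmetric, so it is dominated by a multiple of the integrable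
kernel, uniformly in \<open>x\<close>. By the mean value inequality the difference quotients of the integrand
have the same domination, and dominated convergence applies to the Frechet remainder divided by
\<open>norm v\<close>.\<close>

lemma has_derivative_offset_div:
  fixes G :: "'a::euclidean_space \<times> 'a \<Rightarrow> complex"
  assumes G: "G \<in> antisym_schwartz"
  shows "(offset_div G has_derivative (\<lambda>v. \<Sum>b\<in>Basis. (v \<bullet> b) *\<^sub>R offset_div (diagonal_partial b G) x)) (at x)"
proof -
  let ?I = "offset_integrand" and ?T = diagonal_partial
  let ?D = "\<lambda>v h. \<Sum>b\<in>Basis. (v \<bullet> b) *\<^sub>R ?I (?T b G) x h"
  define r where "r v h = ?I G (x + v) h - ?I G x h - ?D v h" for v h
  define M where "M = (\<Sum>b\<in>Basis. 2 * diagonal_bound (\<lambda>_. 0) (?T b G))"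
  note T = antisym_schwartz_diagonal_partial[OF G]
  note der = has_derivative_offset_integrand[OF antisym_schwartzD[OF G]]
  have D_bound: "norm (\<Sum>b\<in>Basis. (v \<bullet> b) *\<^sub>R ?I (?T b G) y h) \<le> M * offset_kernel h * norm v" for v y h
  proof -
    have "norm (\<Sum>b\<in>Basis. (v \<bullet> b) *\<^sub>R ?I (?T b G) y h)
        \<le> (\<Sum>b\<in>Basis. \<bar>v \<bullet> b\<bar> * norm (?I (?T b G) y h))"
      by (rule order_trans[OF norm_sum]) simp
    also have "\<dots> \<le> (\<Sum>b\<in>Basis. norm v * (2 * diagonal_bound (\<lambda>_. 0) (?T b G) * offset_kernel h))"
      using offset_integrand_bound[OF T, of _ "\<lambda>_. 0" y h]
      by (intro sum_mono mult_mono) (auto simp: Basis_le_norm)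
    finally show ?thesis by (simp add: M_def sum_distrib_left sum_distrib_right mult_ac)
  qed
  have incr: "norm (?I G (x + v) h - ?I G x h) \<le> M * offset_kernel h * norm v" for v h
    using differentiable_bound[of UNIV "\<lambda>y. ?I G y h"
        "\<lambda>y v. \<Sum>b\<in>Basis. (v \<bullet> b) *\<^sub>R ?I (?T b G) y h" "M * offset_kernel h" "x + v" x]
      der D_bound by (simp add: onorm_le)
  have r_bound: "norm (r v h) \<le> 2 * M * offset_kernel h * norm v" for v h
    using norm_triangle_ineq4[of "?I G (x + v) h - ?I G x h" "?D v h"] incr[of v h] D_bound[of v x h]
    by (simp add: r_def)
  have int_D: "integrable lborel (?D v)" for v
    by (intro Bochner_Integration.integrable_sum integrable_scaleR_right integrable_offset_integrand T)
  have int_r: "integrable lborel (r v)" for v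
    unfolding r_def
    by (intro Bochner_Integration.integrable_diff integrable_offset_integrand G int_D)
  have r_int: "offset_div G (x + v) - offset_div G x - (\<Sum>b\<in>Basis. (v \<bullet> b) *\<^sub>R offset_div (?T b G) x)
      = (LINT h|lborel. r v h)" for v
    unfolding offset_div_def r_def
    by (simp add: integrable_offset_integrand G T int_D integral_sum)
  have "(\<lambda>v. norm (offset_div G (x + v) - offset_div G x - (\<Sum>b\<in>Basis. (v \<bullet> b) *\<^sub>R offset_div (?T b G) x)) / norm v)
      \<midarrow>0\<rightarrow> 0"
    unfolding r_int tendsto_at_iff_sequentially
  proof (intro allI impI)
    fix X :: "nat \<Rightarrow> 'a" assume X: "\<forall>i. X i \<in> UNIV - {0}" "X \<longlonglongrightarrow> 0"
    have "(\<lambda>i. LINT h|lborel. r (X i) h /\<^sub>R norm (X i)) \<longlonglongrightarrow> (LINT h|(lborel::'a measure). 0)"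
    proof (rule integral_dominated_convergence)
      show "integrable lborel (\<lambda>h::'a. 2 * M * offset_kernel h)"
        by (intro integrable_mult_right integrable_offset_kernel)
      show "(\<lambda>h. r (X i) h /\<^sub>R norm (X i)) \<in> borel_measurable lborel" for i
        using int_r[of "X i"] by (intro borel_measurable_scaleR) auto
      show "AE h in lborel. norm (r (X i) h /\<^sub>R norm (X i)) \<le> 2 * M * offset_kernel h" for i
        using r_bound[of "X i"] X(1) by (intro AE_I2) (simp add: field_simps)
      show "AE h in lborel. (\<lambda>i. r (X i) h /\<^sub>R norm (X i)) \<longlonglongrightarrow> 0"
      proof (rule AE_I2)
        fix h
        have "(\<lambda>v. norm (r v h) / norm v) \<midarrow>0\<rightarrow> 0"
          using der[of h x] unfolding has_derivative_at r_def by blast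
        then have "((\<lambda>v. norm (r v h) / norm v) \<circ> X) \<longlonglongrightarrow> 0"
          using X unfolding tendsto_at_iff_sequentially by blast
        then show "(\<lambda>i. r (X i) h /\<^sub>R norm (X i)) \<longlonglongrightarrow> 0"
          by (intro tendsto_norm_zero_cancel[of "\<lambda>i. r (X i) h /\<^sub>R norm (X i)"])
            (simp add: o_def divide_inverse mult.commute)
      qed
    qed simp
    then show "((\<lambda>v. norm (LINT h|lborel. r v h) / norm v) \<circ> X) \<longlonglongrightarrow> 0"
      by (simp add: o_def integral_scaleR_right divide_inverse mult.commute tendsto_norm_zero_iff
          flip: tendsto_norm_zero_iff[of "\<lambda>i. inverse (norm (X i)) *\<^sub>R (LINT h|lborel. r (X i) h)"])
  qed
  moreover have "bounded_linear (\<lambda>v. \<Sum>b\<in>Basis. (v \<bullet> b) *\<^sub>R offset_div (?T b G) x)"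
    by (intro bounded_linear_sum bounded_linear_scaleR_const bounded_linear_inner_left)
  ultimately show ?thesis unfolding has_derivative_at by blast
qed

lemma partial_offset_div:
  assumes "G \<in> antisym_schwartz" "b \<in> Basis"
  shows "partial b (offset_div G) = offset_div (diagonal_partial b G)"
proof
  fix x
  have "partial b (offset_div G) x = (\<Sum>c\<in>Basis. (b \<bullet> c) *\<^sub>R offset_div (diagonal_partial c G) x)"
    by (rule has_derivative_partial_eq[OF has_derivative_offset_div[OF assms(1)]])
  also have "\<dots> = (\<Sum>c\<in>Basis. if c = b then offset_div (diagonal_partial c G) x else 0)"
    using assms(2) by (intro sum.cong) (auto simp: inner_Basis)
  also have "\<dots> = offset_div (diagonal_partial b G) x" using assms(2) by simp
  finally show "partial b (offset_div G) x = offset_div (diagonal_partial b G) x" .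
qed

lemma smooth_offset_div:
  fixes G :: "'a::euclidean_space \<times> 'a \<Rightarrow> complex"
  assumes "G \<in> antisym_schwartz"
  shows "smooth (offset_div G)"
proof (rule smooth_coinduct[where P = "\<lambda>f. \<exists>G \<in> antisym_schwartz. f = offset_div G"])
  show "\<exists>G'\<in>antisym_schwartz. offset_div G = offset_div G'" using assms by blast
next
  fix f :: "'a \<Rightarrow> complex" and x assume "\<exists>G\<in>antisym_schwartz. f = offset_div G"
  then show "f differentiable (at x)"
    unfolding differentiable_def using has_derivative_offset_div by blast
next
  fix f :: "'a \<Rightarrow> complex" and b :: 'a
  assume "\<exists>G\<in>antisym_schwartz. f = offset_div G" "b \<in> Basis"
  then show "\<exists>G\<in>antisym_schwartz. partial b f = offset_div G"
    using partial_offset_div antisym_schwartz_diagonal_partial by blast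
qed

text \<open>Arbitrary iterated derivatives of the half-divergence are half-divergences again, so that the
zeroth-order estimate \<open>offset_div_bound\<close> controls all Schwartz seminorms.\<close>

lemma foldr_partial_offset_div:
  assumes "G \<in> antisym_schwartz" "bs \<in> lists Basis"
  shows "foldr diagonal_partial bs G \<in> antisym_schwartz \<and>
    foldr partial bs (offset_div G) = offset_div (foldr diagonal_partial bs G)"
  using assms(2)
  by (induction bs) (use assms(1) in \<open>auto simp: partial_offset_div antisym_schwartz_diagonal_partial\<close>)

lemma seminorm_dominated_foldr_diagonal_partial:
  fixes bs :: "'a::euclidean_space list"
  assumes "bs \<in> lists Basis"
  shows "seminorm_dominated (\<lambda>G. schwartz_seminorm \<alpha> \<beta> (foldr diagonal_partial bs G))"
  using assms
proof (induction bs arbitrary: \<beta>)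
  case Nil
  then show ?case by (simp add: seminorm_dominated_seminorm)
next
  case (Cons b bs)
  let ?F = "foldr diagonal_partial bs"
  have b: "b \<in> Basis" using Cons by blast
  have F: "?F G \<in> schwartz" if "G \<in> schwartz" for G
    using Cons.hyps(2) by (induction bs) (auto simp: that schwartz_diagonal_partial)
  let ?up = "\<lambda>c. \<beta>(c := Suc (\<beta> c))"
  have "seminorm_dominated (\<lambda>G. schwartz_seminorm \<alpha> (?up (b, 0)) (?F G) + schwartz_seminorm \<alpha> (?up (0, b)) (?F G))"
    by (intro seminorm_dominated_add Cons.IH)
  then show ?case
  proof (rule seminorm_dominated_mono)
    fix G :: "'a \<times> 'a \<Rightarrow> complex" assume "G \<in> schwartz"
    note G = F[OF this]
    show "schwartz_seminorm \<alpha> \<beta> (foldr diagonal_partial (b # bs) G)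
      \<le> schwartz_seminorm \<alpha> (?up (b, 0)) (?F G) + schwartz_seminorm \<alpha> (?up (0, b)) (?F G)"
      using schwartz_seminorm_diagonal_partial[OF G b] by simp
  qed
qed

text \<open>For fixed \<open>G\<close> this bounds the Schwartz seminorms of the
half-divergence; applied to a difference of two functions it gives continuity.\<close>

lemma offset_div_seminorm_dominated:
  fixes \<alpha> \<beta> :: "'a::euclidean_space \<Rightarrow> nat"
  obtains p where "seminorm_dominated p"
    "\<And>G x. G \<in> antisym_schwartz \<Longrightarrow> norm (monomial \<alpha> x *\<^sub>R mderiv \<beta> (offset_div G) x) \<le> p G"
proof -
  obtain bs :: "'a list" where bs: "bs \<in> lists Basis"
    and md: "\<And>f. mderiv \<beta> f = foldr partial bs f"
    using mderiv_eq_foldr_partial[of \<beta>] by metis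
  let ?F = "foldr diagonal_partial bs"
  let ?s = "schwartz_seminorm (lift_index \<alpha>)"
  let ?K = "2 * (LINT h|lborel. offset_kernel (h::'a))"
  have F: "?F G \<in> schwartz" if "G \<in> schwartz" for G
    using bs by (induction bs) (auto simp: that schwartz_diagonal_partial)
  have "seminorm_dominated (\<lambda>G. ?s (\<lambda>_. 0) (?F G) + (\<Sum>b\<in>Basis. ?s ((\<lambda>_. 0)((0, b) := Suc 0)) (?F G)))"
    by (intro seminorm_dominated_add seminorm_dominated_sum seminorm_dominated_foldr_diagonal_partial bs finite_Basis)
  then have "seminorm_dominated (\<lambda>G. diagonal_bound \<alpha> (?F G))"
    by (rule seminorm_dominated_mono)
      (simp add: diagonal_bound_def schwartz_seminorm_partial F Pair_Basis)
  then have "seminorm_dominated (\<lambda>G. ?K * diagonal_bound \<alpha> (?F G))"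
    by (rule seminorm_dominated_cmult) (simp add: integral_nonneg_AE offset_kernel_nonneg)
  moreover have "norm (monomial \<alpha> x *\<^sub>R mderiv \<beta> (offset_div G) x) \<le> ?K * diagonal_bound \<alpha> (?F G)"
    if "G \<in> antisym_schwartz" for G x
    using foldr_partial_offset_div[OF that bs] offset_div_bound[of "?F G" \<alpha> x] by (simp add: md)
  ultimately show thesis by (rule that)
qed

lemma schwartz_offset_div:
  fixes G :: "'a::euclidean_space \<times> 'a \<Rightarrow> complex"
  assumes "G \<in> antisym_schwartz"
  shows "offset_div G \<in> schwartz"
proof (rule schwartzI)
  show "smooth (offset_div G)" using assms by (rule smooth_offset_div)
  fix \<alpha> \<beta> :: "'a \<Rightarrow> nat"
  obtain p where "\<And>G x. G \<in> antisym_schwartz \<Longrightarrow> norm (monomial \<alpha> x *\<^sub>R mderiv \<beta> (offset_div G) x) \<le> p G"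
    using offset_div_seminorm_dominated[of \<alpha> \<beta>] by metis
  with assms show "\<exists>B. \<forall>x. norm (monomial \<alpha> x *\<^sub>R mderiv \<beta> (offset_div G) x) \<le> B" by blast
qed

lemma continuous_map_offset_div:
  fixes S :: "('a::euclidean_space \<times> 'a \<Rightarrow> complex) set"
  assumes "S \<subseteq> antisym_schwartz"
  shows "continuous_map (subtopology schwartz_topology S) schwartz_topology offset_div"
proof (rule continuous_map_schwartzI)
  show "S \<subseteq> schwartz" using assms antisym_schwartzD by blast
  show "offset_div G \<in> schwartz" if "G \<in> S" for G using that assms schwartz_offset_div by blast
  fix \<alpha> \<beta> :: "'a \<Rightarrow> nat"
  obtain p where p: "seminorm_dominated p"
    "\<And>G x. G \<in> antisym_schwartz \<Longrightarrow> norm (monomial \<alpha> x *\<^sub>R mderiv \<beta> (offset_div G) x) \<le> p G"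
    using offset_div_seminorm_dominated[of \<alpha> \<beta>] by blast
  have "schwartz_seminorm \<alpha> \<beta> (\<lambda>x. offset_div H x - offset_div G x) \<le> p (\<lambda>z. H z - G z)"
    if "G \<in> S" "H \<in> S" for G H
  proof -
    have GH: "G \<in> antisym_schwartz" "H \<in> antisym_schwartz" using that assms by auto
    have "schwartz_seminorm \<alpha> \<beta> (offset_div (\<lambda>z. H z - G z)) \<le> p (\<lambda>z. H z - G z)"
      by (intro schwartz_seminorm_leI p(2) antisym_schwartz_diff GH)
    then show ?thesis by (simp add: offset_div_diff GH)
  qed
  with p(1) show "\<exists>p. seminorm_dominated p \<and> (\<forall>f\<in>S. \<forall>g\<in>S.
      schwartz_seminorm \<alpha> \<beta> (\<lambda>x. offset_div g x - offset_div f x) \<le> p (\<lambda>z. g z - f z))"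
    by blast
qed

section \<open>Transfer to the half-divergence\<close>

lemma div_half_integrand_translate:
  fixes G :: "(real ^ 'n) \<times> (real ^ 'n) \<Rightarrow> complex"
  shows "div_half_integrand G x (x + h) = offset_integrand G x h"
  by (simp add: div_half_integrand_def offset_integrand_def)

lemma
  fixes G :: "(real ^ 'n) \<times> (real ^ 'n) \<Rightarrow> complex"
  assumes "G \<in> antisym_schwartz"
  shows integrable_div_half_integrand: "integrable lborel (div_half_integrand G x)"
    and div_half_eq_offset_div: "div_half G x = offset_div G x"
proof -
  have "continuous_on UNIV (\<lambda>y. G (x, y))"
    using assms by (intro continuous_on_compose2[OF schwartz_continuous[OF antisym_schwartzD]])
      (auto intro!: continuous_intros)
  then have [measurable]: "(\<lambda>y. G (x, y)) \<in> borel_measurable borel"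
    by (rule borel_measurable_continuous_onI)
  have meas: "div_half_integrand G x \<in> borel_measurable borel"
    unfolding div_half_integrand_def[abs_def] by measurable
  have "integrable (distr lborel borel ((+) x)) (div_half_integrand G x)"
    using integrable_offset_integrand[OF assms, of x]
    by (simp add: integrable_distr_eq meas div_half_integrand_translate)
  then show "integrable lborel (div_half_integrand G x)" by (simp add: lborel_distr_plus)
  have "div_half G x = (LINT y|distr lborel borel ((+) x). div_half_integrand G x y)"
    by (simp add: div_half_def lborel_distr_plus)
  also have "\<dots> = offset_div G x"
    by (simp add: integral_distr meas div_half_integrand_translate offset_div_def)
  finally show "div_half G x = offset_div G x" .
qed

theorem lemma3p2:
  shows "(\<forall>G \<in> (schwartz_od :: ((real ^ 'n) \<times> (real ^ 'n) \<Rightarrow> complex) set).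
           (\<forall>x. integrable lborel (div_half_integrand G x) \<and>
                div_half G x =
                  (LINT y|lborel. (G (x, y) - G (y, x)) / of_real (norm (x - y) powr (1/2))
                     / of_real (norm (x - y) ^ CARD('n)))) \<and>
           div_half G \<in> schwartz) \<and>
         continuous_map
           (subtopology schwartz_topology (schwartz_od :: ((real ^ 'n) \<times> (real ^ 'n) \<Rightarrow> complex) set))
           schwartz_topology div_half"
proof -
  let ?S = "schwartz_od :: ((real ^ 'n) \<times> (real ^ 'n) \<Rightarrow> complex) set"
  have sub: "?S \<subseteq> antisym_schwartz"
    unfolding schwartz_od_def antisym_schwartz_def by blast
  have eq: "div_half G = offset_div G" if "G \<in> ?S" for G
    using div_half_eq_offset_div sub that by blast
  have "div_half G x = (LINT y|lborel. (G (x, y) - G (y, x)) / of_real (norm (x - y) powr (1/2))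
      / of_real (norm (x - y) ^ CARD('n)))" if "G \<in> ?S" for G x
  proof -
    have "2 * G (x, y) = G (x, y) - G (y, x)" for y
    proof -
      have "G (y, x) = - G (x, y)" using that unfolding schwartz_od_def by blast
      then show ?thesis by simp
    qed
    then show ?thesis unfolding div_half_def div_half_integrand_def by simp
  qed
  moreover have "continuous_map (subtopology schwartz_topology ?S) schwartz_topology div_half"
    by (rule continuous_map_eq[OF continuous_map_offset_div[OF sub]]) (simp add: eq)
  moreover have "div_half G \<in> schwartz" if "G \<in> ?S" for G
    using that sub schwartz_offset_div eq by (metis subsetD)
  ultimately show ?thesis
    using integrable_div_half_integrand sub by blast
qed

end
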